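(* Let $A$ be a nonsingular $n\times n$ matrix, let $M$ and $F$ be $n\times n$ matrices, and let $\|\cdot\|$ be an induced matrix norm. Assume that $\|AM-I\|\le\varepsilon<1$. Then $M$ is nonsingular. Define $M_d=M-F$. If $F$ satisfies $$\|F\|<\frac{1-\varepsilon}{\|A\|},$$ then $M_d$ is nonsingular.
   Context: Matrices are real or complex; $I$ is the $n\times n$ identity matrix. The matrix norm $\|\cdot\|$ is an arbitrary induced (operator) matrix norm, i.e. induced by a vector norm on $n$-dimensional space (for example the matrix 1-norm or 2-norm). *)

theory Defs
  imports "HOL-Analysis.Analysis"
begin

text \<open>
  The scalars \<open>'a\<close> range over the real normed fields of class \<open>heine_borel\<close>, which covers both real and complex matrices.  The
  homogeneity clause of a vector norm uses the modulus of scalars in \<open>'a\<close>, so for complex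
  matrices it is complex homogeneity.  The ambient type-class norm of \<open>'a ^ 'n\<close> (the 2-norm)
  plays no role.
\<close>

definition vector_norm :: "('a::real_normed_field ^ 'n::finite \<Rightarrow> real) \<Rightarrow> bool" where
  "vector_norm N \<longleftrightarrow>
     (\<forall>x. 0 \<le> N x) \<and>
     (\<forall>x. N x = 0 \<longleftrightarrow> x = 0) \<and>
     (\<forall>c x. N (c *s x) = norm c * N x) \<and>
     (\<forall>x y. N (x + y) \<le> N x + N y)"

text \<open>
  The supremum is over a nonempty set (all index types are nonempty), which for a vector norm
  over a scalar field of class \<open>heine_borel\<close> is bounded, by equivalence of norms in finite
  dimension.
\<close>

definition induced_norm ::
    "('a::real_normed_field ^ 'n::finite \<Rightarrow> real) \<Rightarrow> 'a ^ 'n ^ 'n \<Rightarrow> real" where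
  "induced_norm N A = (SUP x\<in>{x. x \<noteq> 0}. N (A *v x) / N x)"

end

theory Submission
  imports Defs
begin

text \<open>
  A square matrix over a field is invertible once its kernel is trivial.  If \<open>M x = F x\<close>, then
  \<open>N x \<le> N (A M x - x) + N (A F x) \<le> (\<epsilon> + \<parallel>A\<parallel> \<parallel>F\<parallel>) N x\<close>, and the coefficient is less than 1;
  the case \<open>F = 0\<close> gives the invertibility of \<open>M\<close>.
\<close>

text \<open>Definiteness is left out so that \<open>\<lambda>x. p (A *v x)\<close> stays in the
  class even for singular \<open>A\<close>; the estimates below then apply both to \<open>N\<close>
  and to \<open>N\<close> after a matrix.\<close>

definition seminorm_on_vec :: "('a::real_normed_field ^ 'n::finite \<Rightarrow> real) \<Rightarrow> bool" where
  "seminorm_on_vec p \<longleftrightarrow>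
     (\<forall>c x. p (c *s x) = norm c * p x) \<and> (\<forall>x y. p (x + y) \<le> p x + p y)"

lemma vector_norm_imp_seminorm: "vector_norm N \<Longrightarrow> seminorm_on_vec N"
  by (simp add: vector_norm_def seminorm_on_vec_def)

lemma seminorm_matrix_vector_mult:
  "seminorm_on_vec p \<Longrightarrow> seminorm_on_vec (\<lambda>x. p (A *v x))"
  by (simp add: seminorm_on_vec_def matrix_vector_right_distrib vector_scalar_commute)

context
  fixes p :: "'a::real_normed_field ^ 'n::finite \<Rightarrow> real"
  assumes p: "seminorm_on_vec p"
begin

lemma seminorm_scale: "p (c *s x) = norm c * p x"
  using p by (simp add: seminorm_on_vec_def)

lemma seminorm_triangle: "p (x + y) \<le> p x + p y"
  using p by (simp add: seminorm_on_vec_def)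

lemma seminorm_zero: "p 0 = 0"
  using seminorm_scale[of 0 0] by simp

lemma seminorm_minus: "p (- x) = p x"
  using seminorm_scale[of "-1" x] by simp

text \<open>By evenness, \<open>0 = p (x + - x)\<close> is at most \<open>2 * p x\<close>.\<close>

lemma seminorm_nonneg: "0 \<le> p x"
  using seminorm_triangle[of x "- x"] by (simp add: seminorm_zero seminorm_minus)

lemma seminorm_sum_le: "finite S \<Longrightarrow> p (sum f S) \<le> (\<Sum>i\<in>S. p (f i))"
proof (induction S rule: finite_induct)
  case empty
  then show ?case by (simp add: seminorm_zero)
next
  case (insert i S)
  then show ?case using seminorm_triangle[of "f i" "sum f S"] by simp
qed

text \<open>Expand \<open>x\<close> in the standard basis; each coordinate is bounded by
  \<open>norm x\<close>, the ambient norm.\<close>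

lemma seminorm_le_norm: "p x \<le> (\<Sum>i\<in>UNIV. p (axis i 1)) * norm x"
proof -
  have "p x = p (\<Sum>i\<in>UNIV. x $ i *s axis i 1)"
    by (simp add: basis_expansion)
  also have "\<dots> \<le> (\<Sum>i\<in>UNIV. p (x $ i *s axis i 1))"
    by (simp add: seminorm_sum_le)
  also have "\<dots> \<le> (\<Sum>i\<in>UNIV. norm x * p (axis i 1))"
    by (intro sum_mono) (simp add: seminorm_scale mult_right_mono seminorm_nonneg Finite_Cartesian_Product.norm_nth_le)
  finally show ?thesis by (simp add: sum_distrib_left mult.commute)
qed

text \<open>The reverse triangle inequality makes \<open>p\<close> Lipschitz, with the constant of
  the previous bound.\<close>

lemma continuous_on_seminorm: "continuous_on S p"
proof -
  let ?C = "\<Sum>i\<in>UNIV. p (axis i 1)"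
  have *: "p x - p y \<le> ?C * dist x y" for x y
    using seminorm_triangle[of "x - y" y] seminorm_le_norm[of "x - y"] by (simp add: dist_norm)
  have "?C-lipschitz_on S p"
  proof (rule lipschitz_onI)
    show "dist (p x) (p y) \<le> ?C * dist x y" for x y
      using *[of x y] *[of y x] by (simp add: dist_real_def dist_commute abs_le_iff)
  qed (simp add: sum_nonneg seminorm_nonneg)
  then show ?thesis by (rule lipschitz_on_continuous_on)
qed

end

text \<open>The unit sphere is compact because the scalars are of class \<open>heine_borel\<close>,
  so \<open>N\<close> attains a minimum \<open>m\<close> there. It is positive by definiteness, and
  homogeneity carries the bound to all vectors.\<close>

lemma vector_norm_ge_norm:
  fixes N :: "'a::{real_normed_field, heine_borel} ^ 'n::finite \<Rightarrow> real"
  assumes N: "vector_norm N"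
  obtains m where "0 < m" "\<And>x. m * norm x \<le> N x"
proof -
  note sn = vector_norm_imp_seminorm[OF N]
  let ?S = "sphere (0 :: 'a ^ 'n) 1"
  have "sgn (axis undefined 1) \<in> ?S"
    by (simp add: norm_sgn)
  then have "?S \<noteq> {}" by blast
  moreover have "compact ?S"
    by (simp add: compact_eq_bounded_closed bounded_sphere closed_sphere)
  ultimately obtain u where u: "u \<in> ?S" "\<And>y. y \<in> ?S \<Longrightarrow> N u \<le> N y"
    using continuous_attains_inf[of ?S N] continuous_on_seminorm[OF sn, of ?S] by metis
  have "N u * norm x \<le> N x" for x
  proof (cases "x = 0")
    case True
    then show ?thesis using seminorm_zero[OF sn] by simp
  next
    case False
    \<comment> \<open>Homogeneity of \<open>N\<close> concerns \<open>*s\<close>, whereas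
      normalization in the ambient norm is a real scaling; the two are identified here.\<close>
    have eq: "of_real (inverse (norm x)) *s x = inverse (norm x) *\<^sub>R x"
      by (simp add: vec_eq_iff scaleR_conv_of_real[where 'a='a])
    have "N u \<le> N (of_real (inverse (norm x)) *s x)"
      using False by (intro u(2)) (simp only: eq, simp)
    also have "\<dots> = N x / norm x"
      by (simp add: seminorm_scale[OF sn] norm_inverse divide_inverse_commute)
    finally show ?thesis using False by (simp add: field_simps)
  qed
  moreover have "0 < N u"
    using N u(1) by (auto simp: vector_norm_def less_le)
  ultimately show thesis using that by blast
qed

text \<open>The content is that the quotients are bounded above; only then does the supremum
  dominate each of them.\<close>

lemma induced_norm_bound:
  fixes N :: "'a::{real_normed_field, heine_borel} ^ 'n::finite \<Rightarrow> real"
  assumes N: "vector_norm N"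
  shows "N (A *v x) \<le> induced_norm N A * N x"
proof (cases "x = 0")
  case True
  then show ?thesis using seminorm_zero[OF vector_norm_imp_seminorm[OF N]] by simp
next
  case False
  note snA = seminorm_matrix_vector_mult[OF vector_norm_imp_seminorm[OF N], of A]
  obtain m where m: "0 < m" "\<And>x. m * norm x \<le> N x"
    using vector_norm_ge_norm[OF N] by blast
  have pos: "0 < N y" if "y \<noteq> 0" for y
    using N that by (auto simp: vector_norm_def less_le)
  define C where "C = (\<Sum>i\<in>UNIV. N (A *v axis i 1))"
  have "0 \<le> C"
    unfolding C_def by (intro sum_nonneg) (rule seminorm_nonneg[OF snA])
  \<comment> \<open>The numerator is at most \<open>C * norm y\<close> and the denominator at least
    \<open>m * norm y\<close>.\<close>
  have "N (A *v y) / N y \<le> C / m" if "y \<noteq> 0" for y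
  proof -
    have "N (A *v y) \<le> C * norm y"
      using seminorm_le_norm[OF snA] by (simp add: C_def)
    also have "\<dots> \<le> C * (N y / m)"
      using m \<open>0 \<le> C\<close> by (intro mult_left_mono) (simp_all add: field_simps)
    finally show ?thesis using pos[OF that] by (simp add: field_simps)
  qed
  then have "bdd_above ((\<lambda>y. N (A *v y) / N y) ` {y. y \<noteq> 0})"
    by (auto intro!: bdd_aboveI)
  then have "N (A *v x) / N x \<le> induced_norm N A"
    unfolding induced_norm_def using False by (intro cSUP_upper) auto
  then show ?thesis using pos[OF False] by (simp add: field_simps)
qed

text \<open>Apply the bound to a single nonzero vector and divide by its positive norm.\<close>

lemma induced_norm_nonneg:
  fixes N :: "'a::{real_normed_field, heine_borel} ^ 'n::finite \<Rightarrow> real"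
  assumes N: "vector_norm N"
  shows "0 \<le> induced_norm N A"
proof -
  let ?e = "axis undefined 1 :: 'a ^ 'n"
  have "?e \<noteq> 0" by simp
  then have "0 < N ?e" using N by (auto simp: vector_norm_def less_le)
  moreover have "0 \<le> N (A *v ?e)"
    using N by (simp add: vector_norm_def)
  then have "0 \<le> induced_norm N A * N ?e"
    using induced_norm_bound[OF N, of A ?e] by (rule order_trans)
  ultimately show ?thesis by (simp add: zero_le_mult_iff)
qed

lemma invertible_if_ker_trivial:
  fixes A :: "'a::field ^ 'n::finite ^ 'n"
  assumes "\<And>x. A *v x = 0 \<Longrightarrow> x = 0"
  shows "invertible A"
  using assms by (simp add: invertible_left_inverse matrix_left_invertible_ker)

lemma invertible_diff_if_small:
  fixes A M F :: "'a::{real_normed_field, heine_borel} ^ 'n::finite ^ 'n"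
  assumes N: "vector_norm N"
    and small: "induced_norm N (A ** M - mat 1) + induced_norm N A * induced_norm N F < 1"
  shows "invertible (M - F)"
proof (rule invertible_if_ker_trivial)
  fix x assume "(M - F) *v x = 0"
  then have "M *v x = F *v x"
    by (simp add: matrix_vector_mult_diff_rdistrib)
  \<comment> \<open>Write \<open>x\<close> as \<open>A M x - (A M - I) x\<close> and replace
    \<open>M x\<close> by \<open>F x\<close>.\<close>
  then have x: "x = A *v (F *v x) + - ((A ** M - mat 1) *v x)"
    by (simp add: matrix_vector_mult_diff_rdistrib flip: matrix_vector_mul_assoc)
  note sn = vector_norm_imp_seminorm[OF N]
  have "N x = N (A *v (F *v x) + - ((A ** M - mat 1) *v x))"
    by (rule arg_cong[OF x])
  also have "\<dots> \<le> N (A *v (F *v x)) + N (- ((A ** M - mat 1) *v x))"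
    by (rule seminorm_triangle[OF sn])
  also have "\<dots> \<le> induced_norm N A * (induced_norm N F * N x) + induced_norm N (A ** M - mat 1) * N x"
    unfolding seminorm_minus[OF sn]
  proof (rule add_mono)
    show "N (A *v (F *v x)) \<le> induced_norm N A * (induced_norm N F * N x)"
      using induced_norm_bound[OF N]
        mult_left_mono[OF induced_norm_bound[OF N] induced_norm_nonneg[OF N]]
      by (rule order_trans)
  qed (rule induced_norm_bound[OF N])
  finally have "N x \<le> (induced_norm N (A ** M - mat 1) + induced_norm N A * induced_norm N F) * N x"
    by (simp only: distrib_right mult.assoc add.commute)
  \<comment> \<open>If \<open>N x\<close> were positive, cancelling it would make the coefficient at
    least 1.\<close>
  then have "\<not> 0 < N x"
    using small by (auto simp: not_less mult_le_cancel_right1)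
  then show "x = 0"
    using N unfolding vector_norm_def by (metis less_le)
qed

theorem theorem3p1:
  fixes A M F :: "'a::{real_normed_field, heine_borel} ^ 'n::finite ^ 'n"
    and N :: "'a ^ 'n \<Rightarrow> real"
    and \<epsilon> :: real
  assumes "vector_norm N"
    and "invertible A"
    and "induced_norm N (A ** M - mat 1) \<le> \<epsilon>"
    and "\<epsilon> < 1"
  shows "invertible M \<and>
    (induced_norm N F < (1 - \<epsilon>) / induced_norm N A \<longrightarrow> invertible (M - F))"
proof (intro conjI impI)
  \<comment> \<open>Needed for the case \<open>F = 0\<close>: all quotients vanish, and the supremum
    of a constant is that constant once the index set is nonempty.\<close>
  have "induced_norm N (0 :: 'a ^ 'n ^ 'n) = 0"
  proof -
    have "axis undefined 1 \<in> {x :: 'a ^ 'n. x \<noteq> 0}" by simp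
    then have "{x :: 'a ^ 'n. x \<noteq> 0} \<noteq> {}" by blast
    moreover have "N 0 = 0" using assms(1) by (simp add: vector_norm_def)
    ultimately show ?thesis by (simp add: induced_norm_def)
  qed
  then show "invertible M"
    using invertible_diff_if_small[of N A M 0] assms by simp
next
  assume F: "induced_norm N F < (1 - \<epsilon>) / induced_norm N A"
  \<comment> \<open>Otherwise the quotient is the junk value 0.\<close>
  have "induced_norm N A \<noteq> 0"
    using F induced_norm_nonneg[OF assms(1), of F] by auto
  then have "0 < induced_norm N A"
    using induced_norm_nonneg[OF assms(1), of A] by simp
  then have "induced_norm N A * induced_norm N F < 1 - \<epsilon>"
    using F by (simp add: pos_less_divide_eq mult.commute)
  \<comment> \<open>The two terms are at most \<open>\<epsilon>\<close> and strictly below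
    \<open>1 - \<epsilon>\<close>, so their sum is below 1.\<close>
  then show "invertible (M - F)"
    using assms(3) by (intro invertible_diff_if_small[OF assms(1), of A M F]) linarith
qed

end
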